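(* Let $\sigma\in\{1,i\}$, let $A\in\mathbb C^{m\times m}$ and $B\in\mathbb C^{n\times n}$ be complex matrices, and let $C=C_1+C_2j\in\mathbb H^{m\times n}$ with $C_1,C_2\in\mathbb C^{m\times n}$. Then the set of solutions $X\in\mathbb H^{m\times n}$ of the quaternion matrix equation $AX-X^{\sigma}B=C$ consists of all matrices $X=X_1+X_2j$ in which $X_1,X_2\in\mathbb C^{m\times n}$ are complex matrices satisfying $$AX_1-X_1B=C_1,\qquad AX_2-\sigma^2X_2\bar B=C_2,$$ and the set of solutions $X\in\mathbb H^{m\times n}$ of the quaternion matrix equation $X-AX^{\sigma}B=C$ consists of all matrices $X=X_1+X_2j$ in which $X_1,X_2\in\mathbb C^{m\times n}$ are complex matrices satisfying $$X_1-AX_1B=C_1,\qquad X_2-\sigma^2AX_2\bar B=C_2.$$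
   Context: $\mathbb H$ is the skew field of real quaternions with standard imaginary units $i,j,k$, and $\mathbb C=\{a+bi:a,b\in\mathbb R\}\subset\mathbb H$. For $h\in\mathbb H$ and $\sigma\in\{1,i\}$ put $h^{\sigma}:=\sigma^{-1}h\sigma$ (so $h^1=h$, and $h^{i}=a+bi-cj-dk$ for $h=a+bi+cj+dk$ with $a,b,c,d\in\mathbb R$); for a quaternion matrix $X$, $X^{\sigma}$ is obtained by applying $h\mapsto h^\sigma$ to each entry. $\bar B$ is the entrywise complex conjugate of $B$. Note that $\sigma^2=1$ if $\sigma=1$ and $\sigma^2=-1$ if $\sigma=i$. *)

theory Defs
  imports "HOL-Analysis.Analysis"
begin

datatype quat = Quat (qRe: real) (qIm1: real) (qIm2: real) (qIm3: real)

lemma quat_eq_iff: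
  "x = y \<longleftrightarrow> qRe x = qRe y \<and> qIm1 x = qIm1 y \<and> qIm2 x = qIm2 y \<and> qIm3 x = qIm3 y"
  by (cases x; cases y) simp

instantiation quat :: ab_group_add
begin

definition "0 = Quat 0 0 0 0"
definition "x + y = Quat (qRe x + qRe y) (qIm1 x + qIm1 y) (qIm2 x + qIm2 y) (qIm3 x + qIm3 y)"
definition "- x = Quat (- qRe x) (- qIm1 x) (- qIm2 x) (- qIm3 x)"
definition "x - y = Quat (qRe x - qRe y) (qIm1 x - qIm1 y) (qIm2 x - qIm2 y) (qIm3 x - qIm3 y)"

instance
  by standard
    (simp_all add: quat_eq_iff zero_quat_def plus_quat_def uminus_quat_def minus_quat_def)

end

instantiation quat :: division_ring
begin

definition "1 = Quat 1 0 0 0"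

definition "x * y = Quat
  (qRe x * qRe y - qIm1 x * qIm1 y - qIm2 x * qIm2 y - qIm3 x * qIm3 y)
  (qRe x * qIm1 y + qIm1 x * qRe y + qIm2 x * qIm3 y - qIm3 x * qIm2 y)
  (qRe x * qIm2 y - qIm1 x * qIm3 y + qIm2 x * qRe y + qIm3 x * qIm1 y)
  (qRe x * qIm3 y + qIm1 x * qIm2 y - qIm2 x * qIm1 y + qIm3 x * qRe y)"

definition "inverse x =
  (let N = (qRe x)\<^sup>2 + (qIm1 x)\<^sup>2 + (qIm2 x)\<^sup>2 + (qIm3 x)\<^sup>2
   in Quat (qRe x / N) (- qIm1 x / N) (- qIm2 x / N) (- qIm3 x / N))"

definition "x div y = x * inverse (y :: quat)"

instance
proof
  fix a b c :: quat
  show "a * b * c = a * (b * c)" "(a + b) * c = a * c + b * c" "a * (b + c) = a * b + a * c"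
    by (simp_all add: quat_eq_iff times_quat_def plus_quat_def algebra_simps)
  show "1 * a = a" "a * 1 = a" "(0 :: quat) \<noteq> 1"
    by (simp_all add: quat_eq_iff times_quat_def one_quat_def zero_quat_def)
  show "a div b = a * inverse b"
    by (simp add: divide_quat_def)
  show "inverse (0 :: quat) = 0"
    by (simp add: inverse_quat_def zero_quat_def)
  assume "a \<noteq> 0"
  define N where "N = (qRe a)\<^sup>2 + (qIm1 a)\<^sup>2 + (qIm2 a)\<^sup>2 + (qIm3 a)\<^sup>2"
  have "N \<noteq> 0"
    using \<open>a \<noteq> 0\<close> unfolding N_def quat_eq_iff zero_quat_def
    by (simp add: add_nonneg_eq_0_iff)
  have inv: "inverse a = Quat (qRe a / N) (- qIm1 a / N) (- qIm2 a / N) (- qIm3 a / N)"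
    by (simp add: inverse_quat_def N_def Let_def)
  have "qRe a * qRe a + qIm1 a * qIm1 a + qIm2 a * qIm2 a + qIm3 a * qIm3 a = N"
    by (simp add: N_def power2_eq_square)
  then have "(qRe a * qRe a) / N + (qIm1 a * qIm1 a) / N + (qIm2 a * qIm2 a) / N
      + (qIm3 a * qIm3 a) / N = 1"
    using \<open>N \<noteq> 0\<close> by (simp flip: add_divide_distrib)
  then show "inverse a * a = 1" "a * inverse a = 1"
    unfolding inv by (simp_all add: quat_eq_iff times_quat_def one_quat_def algebra_simps)
qed

end

definition quat_i :: quat where "quat_i = Quat 0 1 0 0"
definition quat_j :: quat where "quat_j = Quat 0 0 1 0"
definition quat_k :: quat where "quat_k = Quat 0 0 0 1"

lemma quat_units:
  "quat_i * quat_i = -1" "quat_j * quat_j = -1" "quat_k * quat_k = -1"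
  "quat_i * quat_j = quat_k" "quat_j * quat_k = quat_i" "quat_k * quat_i = quat_j"
  "quat_j * quat_i = - quat_k" "quat_k * quat_j = - quat_i" "quat_i * quat_k = - quat_j"
  by (simp_all add: quat_i_def quat_j_def quat_k_def times_quat_def one_quat_def uminus_quat_def)

definition quat_of_complex :: "complex \<Rightarrow> quat" where
  "quat_of_complex z = Quat (Re z) (Im z) 0 0"

lemma quat_of_complex_simps:
  "quat_of_complex 1 = 1" "quat_of_complex \<i> = quat_i"
  "quat_of_complex (z + w) = quat_of_complex z + quat_of_complex w"
  "quat_of_complex (z * w) = quat_of_complex z * quat_of_complex w"
  by (simp_all add: quat_of_complex_def one_quat_def quat_i_def plus_quat_def times_quat_def)

lemma inj_quat_of_complex: "inj quat_of_complex"
  by (auto intro!: injI complex_eqI simp: quat_of_complex_def)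

lemma quat_eq_complex_pair:
  "Quat a b c d = quat_of_complex (Complex a b) + quat_of_complex (Complex c d) * quat_j"
  by (simp add: quat_of_complex_def quat_j_def plus_quat_def times_quat_def)

text \<open>The parameter \<open>\<sigma>\<close> is a complex number, used as a quaternion through
  \<^const>\<open>quat_of_complex\<close>; this way \<open>\<sigma>\<^sup>2\<close> can also be a scalar
  in equations between complex matrices.\<close>

definition quat_conj_by :: "complex \<Rightarrow> quat \<Rightarrow> quat" where
  "quat_conj_by \<sigma> h = inverse (quat_of_complex \<sigma>) * h * quat_of_complex \<sigma>"

lemma quat_conj_by_one: "quat_conj_by 1 h = h"
  by (simp add: quat_conj_by_def quat_of_complex_simps)

lemma quat_conj_by_i: "quat_conj_by \<i> (Quat a b c d) = Quat a b (- c) (- d)"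
  by (simp add: quat_conj_by_def quat_of_complex_def inverse_quat_def times_quat_def)

definition quat_matrix :: "complex^'n^'m \<Rightarrow> quat^'n^'m" where
  "quat_matrix X = map_matrix quat_of_complex X"

text \<open>\<open>quat_matrix_of X\<^sub>1 X\<^sub>2\<close> is the matrix \<open>X\<^sub>1 + X\<^sub>2 j\<close>.\<close>

definition quat_matrix_of :: "complex^'n^'m \<Rightarrow> complex^'n^'m \<Rightarrow> quat^'n^'m" where
  "quat_matrix_of X\<^sub>1 X\<^sub>2 = quat_matrix X\<^sub>1 + map_matrix (\<lambda>h. h * quat_j) (quat_matrix X\<^sub>2)"

end

theory Submission
  imports Defs
begin

text \<open>Every quaternion matrix is uniquely \<open>X\<^sub>1 + X\<^sub>2 j\<close> with \<open>X\<^sub>1\<close>, \<open>X\<^sub>2\<close> complex.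
  Since \<open>j z = \<close>\<open>cnj z j\<close> for complex \<open>z\<close>, right multiplication by \<open>B\<close> acts as
  \<open>B\<close> on the first component and as its conjugate on the second; \<open>h \<mapsto> h\<^sup>\<sigma>\<close> fixes the
  first component and scales the second by \<open>\<sigma>\<^sup>2\<close>. Comparing components gives both claims.\<close>

lemma quat_of_complex_diff: "quat_of_complex (z - w) = quat_of_complex z - quat_of_complex w"
  by (simp add: quat_of_complex_def minus_quat_def)

lemma quat_of_complex_sum: "quat_of_complex (sum f S) = (\<Sum>x\<in>S. quat_of_complex (f x))"
proof (induction S rule: infinite_finite_induct)
  case (insert x S)
  then show ?case by (simp add: quat_of_complex_simps)
qed (simp_all add: quat_of_complex_def zero_quat_def)

lemma quat_j_mult_complex: "quat_j * quat_of_complex z = quat_of_complex (cnj z) * quat_j"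
  by (simp add: quat_of_complex_def quat_j_def times_quat_def)

text \<open>Moving \<sigma> to the left past j turns it into its conjugate, so the j-part gains the
  factor \<open>inverse \<sigma> * cnj \<sigma>\<close>, which equals
  \<open>\<sigma>\<^sup>2\<close> for both admissible values.\<close>

lemma quat_conj_by_complex_pair:
  assumes "\<sigma> \<in> {1, \<i>}"
  shows "quat_conj_by \<sigma> (quat_of_complex z + quat_of_complex w * quat_j) =
    quat_of_complex z + quat_of_complex (\<sigma>\<^sup>2 * w) * quat_j"
  using assms
  by (auto simp: quat_conj_by_one quat_conj_by_i quat_of_complex_def quat_j_def plus_quat_def
      times_quat_def)

lemma quat_matrix_nth: "quat_matrix X $ r $ s = quat_of_complex (X $ r $ s)"
  by (simp add: quat_matrix_def map_matrix_def)

lemma quat_matrix_of_nth: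
  "quat_matrix_of X Y $ r $ s = quat_of_complex (X $ r $ s) + quat_of_complex (Y $ r $ s) * quat_j"
  by (simp add: quat_matrix_of_def quat_matrix_nth map_matrix_def)

text \<open>Since 1 and j are independent over the complex numbers, one quaternion equation splits
  into two complex ones.\<close>

lemma quat_matrix_of_eq_iff: "quat_matrix_of X Y = quat_matrix_of X' Y' \<longleftrightarrow> X = X' \<and> Y = Y'"
  by (auto simp: vec_eq_iff quat_matrix_of_nth complex_eq_iff quat_of_complex_def quat_j_def
      plus_quat_def times_quat_def)

lemma quat_matrix_of_cases:
  obtains X Y where "Z = quat_matrix_of X Y"
proof
  \<comment> \<open>As k = ij, the last two coordinates of an entry combine as cj + dk = (c +
    di)j.\<close>
  show "Z = quat_matrix_of (map_matrix (\<lambda>h. Complex (qRe h) (qIm1 h)) Z)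
      (map_matrix (\<lambda>h. Complex (qIm2 h) (qIm3 h)) Z)"
    by (simp add: vec_eq_iff quat_matrix_of_nth map_matrix_def flip: quat_eq_complex_pair)
qed

lemma quat_matrix_of_diff:
  "quat_matrix_of X Y - quat_matrix_of X' Y' = quat_matrix_of (X - X') (Y - Y')"
  by (simp add: vec_eq_iff quat_matrix_of_nth quat_of_complex_diff algebra_simps)

lemma quat_matrix_mult_quat_matrix_of:
  "quat_matrix A ** quat_matrix_of X Y = quat_matrix_of (A ** X) (A ** Y)"
  by (simp add: vec_eq_iff matrix_matrix_mult_def quat_matrix_nth quat_matrix_of_nth
      quat_of_complex_sum quat_of_complex_simps sum_distrib_right distrib_left sum.distrib
      mult.assoc)

lemma quat_matrix_of_mult_quat_matrix:
  "quat_matrix_of X Y ** quat_matrix B = quat_matrix_of (X ** B) (Y ** map_matrix cnj B)"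
  by (simp add: vec_eq_iff matrix_matrix_mult_def quat_matrix_nth quat_matrix_of_nth
      map_matrix_def quat_of_complex_sum quat_of_complex_simps sum_distrib_right distrib_right
      sum.distrib mult.assoc quat_j_mult_complex)

lemma map_quat_conj_by_quat_matrix_of:
  assumes "\<sigma> \<in> {1, \<i>}"
  shows "map_matrix (quat_conj_by \<sigma>) (quat_matrix_of X Y) =
    quat_matrix_of X (map_matrix ((*) (\<sigma>\<^sup>2)) Y)"
  using quat_conj_by_complex_pair[OF assms]
  by (simp add: vec_eq_iff map_matrix_def quat_matrix_of_nth)

text \<open>Conjugation puts the scalar \<open>\<sigma>\<^sup>2\<close> on the inner factor
  \<open>X\<^sub>2\<close>; these rules pull it out of the products, where the claimed equations
  have it.\<close>

lemma map_matrix_scale_mult: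
  fixes c :: "'a::comm_semiring_1"
  shows "map_matrix ((*) c) X ** Y = map_matrix ((*) c) (X ** Y)"
    and "X ** map_matrix ((*) c) Y = map_matrix ((*) c) (X ** Y)"
  by (simp_all add: vec_eq_iff map_matrix_def matrix_matrix_mult_def sum_distrib_left mult_ac)

theorem theorem4:
  fixes \<sigma> :: complex
    and A :: "complex^'m^'m" and B :: "complex^'n^'n"
    and C :: "quat^'n^'m" and C\<^sub>1 C\<^sub>2 :: "complex^'n^'m"
  assumes "\<sigma> \<in> {1, \<i>}"
    and "C = quat_matrix_of C\<^sub>1 C\<^sub>2"
  shows "{X. quat_matrix A ** X - map_matrix (quat_conj_by \<sigma>) X ** quat_matrix B = C} =
           {quat_matrix_of X\<^sub>1 X\<^sub>2 | X\<^sub>1 X\<^sub>2.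
              A ** X\<^sub>1 - X\<^sub>1 ** B = C\<^sub>1 \<and>
              A ** X\<^sub>2 - map_matrix ((*) (\<sigma>\<^sup>2)) (X\<^sub>2 ** map_matrix cnj B) = C\<^sub>2} \<and>
         {X. X - quat_matrix A ** map_matrix (quat_conj_by \<sigma>) X ** quat_matrix B = C} =
           {quat_matrix_of X\<^sub>1 X\<^sub>2 | X\<^sub>1 X\<^sub>2.
              X\<^sub>1 - A ** X\<^sub>1 ** B = C\<^sub>1 \<and>
              X\<^sub>2 - map_matrix ((*) (\<sigma>\<^sup>2)) (A ** X\<^sub>2 ** map_matrix cnj B) = C\<^sub>2}"
proof -
  note component_simps = quat_matrix_mult_quat_matrix_of quat_matrix_of_mult_quat_matrix
    map_quat_conj_by_quat_matrix_of[OF assms(1)] quat_matrix_of_diff quat_matrix_of_eq_iff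
    map_matrix_scale_mult assms(2)
  \<comment> \<open>Because the pairs exhaust all quaternion matrices, each set equality reduces to
    an equivalence for a single pair.\<close>
  have solution_set: "{X. P X} = {quat_matrix_of X\<^sub>1 X\<^sub>2 | X\<^sub>1 X\<^sub>2. Q X\<^sub>1 X\<^sub>2}"
    if "\<And>X\<^sub>1 X\<^sub>2. P (quat_matrix_of X\<^sub>1 X\<^sub>2) \<longleftrightarrow> Q X\<^sub>1 X\<^sub>2" for P :: "quat^'n^'m \<Rightarrow> bool" and Q
    using that by (auto elim: quat_matrix_of_cases) (metis quat_matrix_of_cases)
  show ?thesis
    by (intro conjI solution_set; simp only: component_simps)
qed

end
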